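(* Let $n\geq 4$ and let $P$ be a convex $n$-gon. If $T_1$ and $T_2$ are triangulations of $P$ whose sets of internal triangles coincide (i.e. the internal triangles of $T_1$ are exactly the internal triangles of $T_2$, as triangles with vertices among those of $P$), then the number of triangulations of $P$ disjoint from $T_1$ equals the number of triangulations of $P$ disjoint from $T_2$. In other words, the number of triangulations disjoint from a triangulation $T$ depends only on the position of the internal triangles of $T$.
   Context: A triangulation of a convex polygon $P$ uses non-crossing diagonals to divide $P$ into triangles. An internal triangle of a triangulation is one of its triangles that shares no side with $P$. Two triangulations of $P$ are disjoint if they have no diagonals in common. *)

theory Defs
  imports Main
begin

text \<open>Combinatorial model of a convex n-gon P: vertices 0,...,n-1 in cyclic order.
  A segment between two vertices is the doubleton set of its endpoints.\<close>

definition is_side :: "nat \<Rightarrow> nat \<Rightarrow> nat \<Rightarrow> bool" where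
  "is_side n i j \<longleftrightarrow> i < n \<and> j < n \<and> (j = (i + 1) mod n \<or> i = (j + 1) mod n)"

definition diagonals :: "nat \<Rightarrow> nat set set" where
  "diagonals n = {{i, j} | i j. i < n \<and> j < n \<and> i \<noteq> j \<and> \<not> is_side n i j}"

text \<open>Two chords of a convex polygon cross (in their interiors) iff their endpoints interleave.\<close>
definition crosses :: "nat set \<Rightarrow> nat set \<Rightarrow> bool" where
  "crosses d1 d2 \<longleftrightarrow> (\<exists>a b c d. a < c \<and> c < b \<and> b < d \<and>
      ((d1 = {a, b} \<and> d2 = {c, d}) \<or> (d1 = {c, d} \<and> d2 = {a, b})))"

definition noncrossing :: "nat set set \<Rightarrow> bool" where
  "noncrossing S \<longleftrightarrow> (\<forall>d1\<in>S. \<forall>d2\<in>S. \<not> crosses d1 d2)"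

definition triangulation :: "nat \<Rightarrow> nat set set \<Rightarrow> bool" where
  "triangulation n T \<longleftrightarrow> T \<subseteq> diagonals n \<and> noncrossing T \<and>
     (\<forall>d \<in> diagonals n - T. \<not> noncrossing (insert d T))"

definition triangles :: "nat \<Rightarrow> nat set set \<Rightarrow> nat set set" where
  "triangles n T = {{a, b, c} | a b c. a < b \<and> b < c \<and> c < n \<and>
      (is_side n a b \<or> {a, b} \<in> T) \<and> (is_side n b c \<or> {b, c} \<in> T) \<and>
      (is_side n a c \<or> {a, c} \<in> T)}"

definition internal_triangles :: "nat \<Rightarrow> nat set set \<Rightarrow> nat set set" where
  "internal_triangles n T = {t \<in> triangles n T. \<forall>i\<in>t. \<forall>j\<in>t. i \<noteq> j \<longrightarrow> \<not> is_side n i j}"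

definition disjoint_triangs :: "nat set set \<Rightarrow> nat set set \<Rightarrow> bool" where
  "disjoint_triangs T1 T2 \<longleftrightarrow> T1 \<inter> T2 = {}"

end

theory Submission
  imports Defs "HOL-Library.Infinite_Set"
begin

text \<open>The number of triangulations avoiding a set \<open>S\<close> of non-crossing chords satisfies a
  deletion-contraction rule: avoiding \<open>S\<close> and one more chord \<open>d\<close> is avoiding \<open>S\<close>, minus the product
  of the two counts in the polygons on either side of \<open>d\<close>. Unfolding this rule for a triangulation
  \<open>T\<close> expresses the count through the dual tree of \<open>T\<close> alone: each cell of a dissection by chords
  of \<open>T\<close> contributes the number of triangulations of a polygon determined by the number of triangles
  in the cell. Rooting the dual tree at a side of the polygon makes it a binary tree, and the
  resulting value is unchanged under swapping the two subtrees of a node and under moving the root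
  along triangles with a side on the boundary. The internal triangles are the branching nodes of the
  dual tree; the pieces between them are paths whose lengths are determined by counting vertices, so
  the internal triangles determine the tree up to these symmetries.\<close>

section \<open>Chords and triangulations of a finite set of points\<close>

text \<open>The diagonals of the convex polygon whose vertices are the points of \<open>V\<close> in
  increasing order: a vertex must lie on either side of the segment. Vertex sets need not be
  intervals, since cutting off a piece along a chord leaves a gap.\<close>

definition chords :: "nat set \<Rightarrow> nat set set" where
  "chords V = {{a, b} | a b. a \<in> V \<and> b \<in> V \<and> a < b \<and>
     (\<exists>x\<in>V. a < x \<and> x < b) \<and> (\<exists>x\<in>V. x < a \<or> b < x)}"

text \<open>A single fixed-point equation: one inclusion makes \<open>T\<close> a non-crossing set
  of chords, the other makes it maximal.\<close>

definition triang :: "nat set \<Rightarrow> nat set set \<Rightarrow> bool" where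
  "triang V T \<longleftrightarrow> T = {d \<in> chords V. \<forall>e\<in>T. \<not> crosses d e}"

text \<open>Integer-valued, so that deletion-contraction can subtract without truncation.\<close>

definition avoiding :: "nat set \<Rightarrow> nat set set \<Rightarrow> int" where
  "avoiding V S = int (card {T. triang V T \<and> T \<inter> S = {}})"

lemma crosses_iff:
  assumes "a < b" "c < d"
  shows "crosses {a, b} {c, d} \<longleftrightarrow> (a < c \<and> c < b \<and> b < d) \<or> (c < a \<and> a < d \<and> d < b)"
proof
  assume "crosses {a, b} {c, d}"
  then obtain p q r s where o: "p < r" "r < q" "q < s"
    and "({a, b} = {p, q} \<and> {c, d} = {r, s}) \<or> ({a, b} = {r, s} \<and> {c, d} = {p, q})"
    unfolding crosses_def by blast
  with assms o show "(a < c \<and> c < b \<and> b < d) \<or> (c < a \<and> a < d \<and> d < b)"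
    by (auto simp: doubleton_eq_iff)
next
  assume "(a < c \<and> c < b \<and> b < d) \<or> (c < a \<and> a < d \<and> d < b)"
  then show "crosses {a, b} {c, d}" unfolding crosses_def by blast
qed

lemma crosses_sym: "crosses d e \<longleftrightarrow> crosses e d"
  unfolding crosses_def by blast

lemma chordsE:
  assumes "e \<in> chords V"
  obtains a b x y where "e = {a, b}" "a < b" "a \<in> V" "b \<in> V" "x \<in> V" "a < x" "x < b"
    "y \<in> V" "y < a \<or> b < y"
  using assms unfolding chords_def by blast

lemma chords_iff:
  assumes "a < b"
  shows "{a, b} \<in> chords V \<longleftrightarrow>
    a \<in> V \<and> b \<in> V \<and> (\<exists>x\<in>V. a < x \<and> x < b) \<and> (\<exists>x\<in>V. x < a \<or> b < x)"
proof
  assume "{a, b} \<in> chords V"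
  then obtain c d where "{a, b} = {c, d}" "c < d" "c \<in> V \<and> d \<in> V \<and> (\<exists>x\<in>V. c < x \<and> x < d) \<and> (\<exists>x\<in>V. x < c \<or> d < x)"
    unfolding chords_def by blast
  moreover have "a = c" "b = d" using calculation(1,2) assms by (auto simp: doubleton_eq_iff)
  ultimately show "a \<in> V \<and> b \<in> V \<and> (\<exists>x\<in>V. a < x \<and> x < b) \<and> (\<exists>x\<in>V. x < a \<or> b < x)" by simp
next
  assume "a \<in> V \<and> b \<in> V \<and> (\<exists>x\<in>V. a < x \<and> x < b) \<and> (\<exists>x\<in>V. x < a \<or> b < x)"
  with assms show "{a, b} \<in> chords V" unfolding chords_def by blast
qed

lemma chords_mono: "V \<subseteq> W \<Longrightarrow> chords V \<subseteq> chords W"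
  unfolding chords_def by blast

lemma chords_subset_Pow: "chords V \<subseteq> Pow V"
  unfolding chords_def by blast

lemma not_crosses_self: "e \<in> chords V \<Longrightarrow> \<not> crosses e e"
  by (elim chordsE) (simp add: crosses_iff)

lemma triangD: "triang V T \<Longrightarrow> d \<in> T \<Longrightarrow> d \<in> chords V \<and> (\<forall>e\<in>T. \<not> crosses d e)"
  unfolding triang_def by blast

lemma triang_maximal:
  "triang V T \<Longrightarrow> d \<in> chords V \<Longrightarrow> \<forall>e\<in>T. \<not> crosses d e \<Longrightarrow> d \<in> T"
  unfolding triang_def by blast

lemma triang_subset: "triang V T \<Longrightarrow> T \<subseteq> chords V"
  unfolding triang_def by blast

lemma finite_triangs: "finite V \<Longrightarrow> finite {T. triang V T \<and> P T}"
  by (rule finite_subset[of _ "Pow (Pow V)"])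
    (use triang_subset chords_subset_Pow in blast, simp)

lemma avoiding_cong: "S \<inter> chords V = S' \<inter> chords V \<Longrightarrow> avoiding V S = avoiding V S'"
proof -
  assume "S \<inter> chords V = S' \<inter> chords V"
  then have "{T. triang V T \<and> T \<inter> S = {}} = {T. triang V T \<and> T \<inter> S' = {}}"
    using triang_subset by blast
  then show ?thesis by (simp add: avoiding_def)
qed

section \<open>Cutting along a chord\<close>

text \<open>The segment \<open>{a, b}\<close> cuts \<open>V\<close> into the polygons
  \<open>V \<inter> {a..b}\<close> and \<open>V - {a<..<b}\<close>. A crossing would put an endpoint
  of \<open>e'\<close> strictly between those of \<open>e\<close>, hence into the removed open
  interval.\<close>

lemma chords_left_not_crosses_right:
  assumes "e \<in> chords (V \<inter> {a..b})" "e' \<in> chords (V - {a<..<b})"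
  shows "\<not> crosses e e'"
  using assms by (elim chordsE) (auto simp: crosses_iff)

lemma chord_not_crosses_left:
  assumes "a < b" "e \<in> chords (V \<inter> {a..b})"
  shows "\<not> crosses {a, b} e" "e \<noteq> {a, b}"
  using assms by (elim chordsE, auto simp: crosses_iff doubleton_eq_iff)+

lemma chord_not_crosses_right:
  assumes "a < b" "e \<in> chords (V - {a<..<b})"
  shows "\<not> crosses {a, b} e" "e \<noteq> {a, b}"
proof -
  obtain p q x y where e: "e = {p, q}" "p < q" "p \<in> V - {a<..<b}" "q \<in> V - {a<..<b}"
    "x \<in> V - {a<..<b}" "p < x" "x < q"
    using assms(2) by (elim chordsE)
  show "\<not> crosses {a, b} e" using e assms(1) by (auto simp: crosses_iff)
  show "e \<noteq> {a, b}" using e assms(1) by (auto simp: doubleton_eq_iff)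
qed

lemma chords_left_right_disjoint:
  assumes "a < b"
  shows "chords (V \<inter> {a..b}) \<inter> chords (V - {a<..<b}) = {}"
proof (rule ccontr)
  assume "\<not> ?thesis"
  then obtain e where e: "e \<in> chords (V \<inter> {a..b})" "e \<in> chords (V - {a<..<b})" by blast
  then obtain p q where pq: "e = {p, q}" "p < q" by (elim chordsE)
  have "e \<subseteq> V \<inter> {a..b}" "e \<subseteq> V - {a<..<b}"
    using e chords_subset_Pow by blast+
  then have "p \<in> {a, b}" "q \<in> {a, b}" using pq by auto
  then have "p = a" "q = b" using pq assms by auto
  then show False using chord_not_crosses_left(2)[OF assms e(1)] pq by simp
qed

text \<open>Without a crossing, both endpoints of \<open>e\<close> fall into the same piece. It
  remains to find, within that piece, a vertex on either side of \<open>e\<close>.\<close>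

lemma chords_split:
  assumes "a < b" "a \<in> V" "b \<in> V" "e \<in> chords V" "\<not> crosses {a, b} e"
  shows "e = {a, b} \<or> e \<in> chords (V \<inter> {a..b}) \<or> e \<in> chords (V - {a<..<b})"
proof -
  obtain p q x y where e: "e = {p, q}" "p < q" "p \<in> V" "q \<in> V"
    "x \<in> V" "p < x" "x < q" "y \<in> V" "y < p \<or> q < y"
    using assms(4) by (elim chordsE)
  have nc: "\<not> (a < p \<and> p < b \<and> b < q)" "\<not> (p < a \<and> a < q \<and> q < b)"
    using assms(1,5) e by (auto simp: crosses_iff)
  consider "p = a \<and> q = b" | "a \<le> p \<and> q \<le> b \<and> (a < p \<or> q < b)" | "(p \<le> a \<or> b \<le> p) \<and> (q \<le> a \<or> b \<le> q)
     \<and> \<not> (p = a \<and> q = b)"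
    using nc e(2) assms(1) by linarith
  then show ?thesis
  proof cases
    case 1 then show ?thesis using e by simp
  next
    case 2
    then have "{p, q} \<in> chords (V \<inter> {a..b})"
      unfolding chords_iff[OF e(2)] using e assms by (auto intro: bexI[of _ x] bexI[of _ a] bexI[of _ b])
    then show ?thesis using e by simp
  next
    case 3
    \<comment> \<open>If the cut removes \<open>x\<close>, then \<open>a\<close> or \<open>b\<close>
      replaces it: \<open>p\<close> and \<open>q\<close> lie outside the open interval and are not
      exactly its two ends. The same is done for \<open>y\<close> below.\<close>
    have "\<exists>z\<in>V - {a<..<b}. p < z \<and> z < q"
    proof (cases "x \<in> {a<..<b}")
      case True
      then have "(p < a \<and> a < q) \<or> (p < b \<and> b < q)" using e 3 assms(1) by auto
      then show ?thesis using assms by auto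
    qed (use e in auto)
    moreover have "\<exists>z\<in>V - {a<..<b}. z < p \<or> q < z"
    proof (cases "y \<in> {a<..<b}")
      case True
      then have "(a < p \<or> q < a) \<or> (b < p \<or> q < b)" using e 3 assms(1) by auto
      then show ?thesis using assms by auto
    qed (use e in auto)
    ultimately have "{p, q} \<in> chords (V - {a<..<b})"
      unfolding chords_iff[OF e(2)] using e 3 by auto
    then show ?thesis using e by simp
  qed
qed

text \<open>Maximality survives restriction: every other member of \<open>T\<close> is
  \<open>{a, b}\<close> or a chord of the opposite piece, and neither can cross a chord of this
  piece.\<close>

lemma triang_restrict_left:
  assumes "a < b" "a \<in> V" "b \<in> V" "triang V T" "\<forall>e\<in>T. \<not> crosses {a, b} e"
  shows "triang (V \<inter> {a..b}) (T \<inter> chords (V \<inter> {a..b}))"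
proof -
  have "d \<in> T" if d: "d \<in> chords (V \<inter> {a..b})"
    "\<forall>e\<in>T \<inter> chords (V \<inter> {a..b}). \<not> crosses d e" for d
  proof (rule triang_maximal[OF assms(4)])
    show "d \<in> chords V" using d(1) chords_mono[of "V \<inter> {a..b}" V] by blast
    show "\<forall>e\<in>T. \<not> crosses d e"
    proof
      fix e assume e: "e \<in> T"
      then have "e \<in> chords V" "\<not> crosses {a, b} e" using assms triangD by blast+
      from chords_split[OF assms(1-3) this] show "\<not> crosses d e"
        using d e chord_not_crosses_left[OF assms(1) d(1)] chords_left_not_crosses_right[OF d(1)]
        by (auto simp: crosses_sym[of d])
    qed
  qed
  then show ?thesis using triangD[OF assms(4)] unfolding triang_def by blast
qed

lemma triang_restrict_right:
  assumes "a < b" "a \<in> V" "b \<in> V" "triang V T" "\<forall>e\<in>T. \<not> crosses {a, b} e"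
  shows "triang (V - {a<..<b}) (T \<inter> chords (V - {a<..<b}))"
proof -
  have "d \<in> T" if d: "d \<in> chords (V - {a<..<b})"
    "\<forall>e\<in>T \<inter> chords (V - {a<..<b}). \<not> crosses d e" for d
  proof (rule triang_maximal[OF assms(4)])
    show "d \<in> chords V" using d(1) chords_mono[of "V - {a<..<b}" V] by blast
    show "\<forall>e\<in>T. \<not> crosses d e"
    proof
      fix e assume e: "e \<in> T"
      then have "e \<in> chords V" "\<not> crosses {a, b} e" using assms triangD by blast+
      from chords_split[OF assms(1-3) this] show "\<not> crosses d e"
        using d e chord_not_crosses_right[OF assms(1) d(1)] chords_left_not_crosses_right[OF _ d(1)]
        by (auto simp: crosses_sym[of d])
    qed
  qed
  then show ?thesis using triangD[OF assms(4)] unfolding triang_def by blast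
qed

text \<open>For maximality, a chord compatible with the glued set does not cross
  \<open>{a, b}\<close>, so unless it equals \<open>{a, b}\<close> it lies in one piece, where the
  maximality of \<open>T1\<close> or \<open>T2\<close> applies.\<close>

lemma triang_glue:
  assumes "a < b" "{a, b} \<in> chords V"
    and "triang (V \<inter> {a..b}) T1" "triang (V - {a<..<b}) T2"
  shows "triang V (insert {a, b} (T1 \<union> T2))"
proof -
  let ?T = "insert {a, b} (T1 \<union> T2)"
  have V: "a \<in> V" "b \<in> V" using assms(2) chords_iff[OF assms(1)] by auto
  have sub: "T1 \<subseteq> chords (V \<inter> {a..b})" "T2 \<subseteq> chords (V - {a<..<b})"
    using assms(3,4) triang_subset by auto
  have cV: "chords (V \<inter> {a..b}) \<subseteq> chords V" "chords (V - {a<..<b}) \<subseteq> chords V"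
    by (rule chords_mono, blast)+
  have "d \<in> ?T \<longleftrightarrow> d \<in> chords V \<and> (\<forall>e\<in>?T. \<not> crosses d e)" for d
  proof
    assume d: "d \<in> ?T"
    then consider "d = {a, b}" | "d \<in> T1" | "d \<in> T2" by blast
    then show "d \<in> chords V \<and> (\<forall>e\<in>?T. \<not> crosses d e)"
    proof cases
      case 1
      then show ?thesis
        using assms(2) sub not_crosses_self[OF assms(2)] chord_not_crosses_left(1)[OF assms(1)]
          chord_not_crosses_right(1)[OF assms(1)] by blast
    next
      case 2
      then show ?thesis
        using sub cV triangD[OF assms(3) 2] chord_not_crosses_left(1)[OF assms(1), of d V]
          chords_left_not_crosses_right[of d V a b] crosses_sym by blast
    next
      case 3
      then show ?thesis
        using sub cV triangD[OF assms(4) 3] chord_not_crosses_right(1)[OF assms(1), of d V]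
          chords_left_not_crosses_right[of _ V a b d] crosses_sym by blast
    qed
  next
    assume d: "d \<in> chords V \<and> (\<forall>e\<in>?T. \<not> crosses d e)"
    then have "\<not> crosses {a, b} d" using crosses_sym by blast
    with chords_split[OF assms(1) V] d have
      "d = {a, b} \<or> d \<in> chords (V \<inter> {a..b}) \<or> d \<in> chords (V - {a<..<b})" by blast
    then show "d \<in> ?T" using triang_maximal[OF assms(3)] triang_maximal[OF assms(4)] d by blast
  qed
  then show ?thesis unfolding triang_def by blast
qed

text \<open>Restricting to the two pieces and gluing along \<open>{a, b}\<close> are inverse to each
  other.\<close>

lemma card_triang_containing:
  assumes "a < b" "{a, b} \<in> chords V" "{a, b} \<notin> S"
  shows "int (card {T. triang V T \<and> {a, b} \<in> T \<and> T \<inter> S = {}})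
    = avoiding (V \<inter> {a..b}) S * avoiding (V - {a<..<b}) S"
proof -
  let ?L = "{T. triang (V \<inter> {a..b}) T \<and> T \<inter> S = {}}"
  let ?R = "{T. triang (V - {a<..<b}) T \<and> T \<inter> S = {}}"
  let ?X = "{T. triang V T \<and> {a, b} \<in> T \<and> T \<inter> S = {}}"
  let ?f = "\<lambda>(T1, T2). insert {a, b} (T1 \<union> T2)"
  have V: "a \<in> V" "b \<in> V" using assms(2) chords_iff[OF assms(1)] by auto
  have parts: "(insert {a, b} (T1 \<union> T2)) \<inter> chords (V \<inter> {a..b}) = T1"
    "(insert {a, b} (T1 \<union> T2)) \<inter> chords (V - {a<..<b}) = T2"
    if "triang (V \<inter> {a..b}) T1" "triang (V - {a<..<b}) T2" for T1 T2
    using triang_subset[OF that(1)] triang_subset[OF that(2)]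
      chords_left_right_disjoint[OF assms(1), of V]
      chord_not_crosses_left(2)[OF assms(1), of _ V] chord_not_crosses_right(2)[OF assms(1), of _ V]
    by blast+
  have "bij_betw ?f (?L \<times> ?R) ?X"
  proof (rule bij_betw_imageI)
    show "inj_on ?f (?L \<times> ?R)"
    proof (rule inj_onI)
      fix p q assume pq: "p \<in> ?L \<times> ?R" "q \<in> ?L \<times> ?R" "?f p = ?f q"
      obtain p1 p2 q1 q2 where [simp]: "p = (p1, p2)" "q = (q1, q2)" by fastforce
      have "p1 = q1" "p2 = q2" using parts[of p1 p2] parts[of q1 q2] pq by auto
      then show "p = q" by simp
    qed
    show "?f ` (?L \<times> ?R) = ?X"
    proof
      show "?f ` (?L \<times> ?R) \<subseteq> ?X"
        using triang_glue[OF assms(1,2)] assms(3) by auto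
      show "?X \<subseteq> ?f ` (?L \<times> ?R)"
      proof
        fix T assume T: "T \<in> ?X"
        then have nc: "\<forall>e\<in>T. \<not> crosses {a, b} e" using triangD by blast
        let ?p = "(T \<inter> chords (V \<inter> {a..b}), T \<inter> chords (V - {a<..<b}))"
        have "?p \<in> ?L \<times> ?R"
          using triang_restrict_left[OF assms(1) V _ nc] triang_restrict_right[OF assms(1) V _ nc] T
          by blast
        moreover have "T = ?f ?p"
          using chords_split[OF assms(1) V] nc T triang_subset[of V T] by auto
        ultimately show "T \<in> ?f ` (?L \<times> ?R)" by blast
      qed
    qed
  qed
  from bij_betw_same_card[OF this] show ?thesis
    unfolding avoiding_def by (simp add: card_cartesian_product flip: of_nat_mult)
qed

text \<open>Deletion-contraction: the triangulations avoiding \<open>S\<close> are split according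
  to whether they use \<open>{a, b}\<close>.\<close>

lemma avoiding_insert:
  assumes "finite V" "a < b" "{a, b} \<in> chords V" "{a, b} \<notin> S"
  shows "avoiding V (insert {a, b} S) =
    avoiding V S - avoiding (V \<inter> {a..b}) S * avoiding (V - {a<..<b}) S"
proof -
  let ?X = "{T. triang V T \<and> {a, b} \<in> T \<and> T \<inter> S = {}}"
  let ?Y = "{T. triang V T \<and> T \<inter> insert {a, b} S = {}}"
  have "{T. triang V T \<and> T \<inter> S = {}} = ?X \<union> ?Y" by blast
  moreover have "card (?X \<union> ?Y) = card ?X + card ?Y"
    using finite_triangs[OF assms(1)] by (intro card_Un_disjoint) auto
  ultimately show ?thesis
    using card_triang_containing[OF assms(2-4)] unfolding avoiding_def by simp
qed

section \<open>The number of triangulations depends only on the number of vertices\<close>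

lemma strict_mono_on_less_iff:
  assumes "strict_mono_on V h" "x \<in> V" "y \<in> V"
  shows "(h x :: nat) < h y \<longleftrightarrow> x < (y :: nat)"
  using assms by (metis less_asym linorder_neqE_nat less_irrefl strict_mono_onD)

lemma chords_image:
  assumes h: "strict_mono_on V (h :: nat \<Rightarrow> nat)"
  shows "chords (h ` V) = (`) h ` chords V"
proof -
  note less = strict_mono_on_less_iff[OF h]
  have iff: "{h a, h b} \<in> chords (h ` V) \<longleftrightarrow> {a, b} \<in> chords V" if "a \<in> V" "b \<in> V" "a < b" for a b
    using that by (simp add: chords_iff less)
  show ?thesis
  proof
    show "chords (h ` V) \<subseteq> (`) h ` chords V"
    proof
      fix e assume e: "e \<in> chords (h ` V)"
      then obtain a b where ab: "e = {h a, h b}" "h a < h b" "a \<in> V" "b \<in> V"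
        by (elim chordsE) blast
      then have "{a, b} \<in> chords V" using iff[of a b] less e by auto
      then show "e \<in> (`) h ` chords V" using ab by (intro image_eqI[of _ _ "{a, b}"]) auto
    qed
    show "(`) h ` chords V \<subseteq> chords (h ` V)"
    proof
      fix e assume "e \<in> (`) h ` chords V"
      then obtain d where d: "d \<in> chords V" "e = h ` d" by blast
      then obtain a b where ab: "d = {a, b}" "a < b" "a \<in> V" "b \<in> V" by (elim chordsE)
      with iff[of a b] d show "e \<in> chords (h ` V)" by simp
    qed
  qed
qed

lemma crosses_image:
  assumes h: "strict_mono_on V (h :: nat \<Rightarrow> nat)" and "d \<in> chords V" "e \<in> chords V"
  shows "crosses (h ` d) (h ` e) \<longleftrightarrow> crosses d e"
proof -
  obtain a b c c' where "d = {a, b}" "a < b" "a \<in> V" "b \<in> V" "e = {c, c'}" "c < c'" "c \<in> V" "c' \<in> V"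
    using assms(2,3) by (elim chordsE)
  then show ?thesis by (simp add: crosses_iff strict_mono_on_less_iff[OF h])
qed

lemma triang_image:
  assumes h: "strict_mono_on V (h :: nat \<Rightarrow> nat)" and T: "T \<subseteq> chords V"
  shows "triang (h ` V) ((`) h ` T) \<longleftrightarrow> triang V T"
proof -
  have inj: "inj_on ((`) h) (chords V)"
    using inj_on_image_Pow[OF strict_mono_on_imp_inj_on[OF h]] chords_subset_Pow inj_on_subset by blast
  have "{d \<in> chords (h ` V). \<forall>e\<in>(`) h ` T. \<not> crosses d e}
      = (`) h ` {d \<in> chords V. \<forall>e\<in>T. \<not> crosses d e}"
  proof -
    have "{d \<in> chords V. \<forall>e\<in>(`) h ` T. \<not> crosses (h ` d) e} =
        {d \<in> chords V. \<forall>e\<in>T. \<not> crosses d e}"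
      using crosses_image[OF h] T by auto
    then show ?thesis unfolding chords_image[OF h] Compr_image_eq by simp
  qed
  moreover have "(`) h ` T = (`) h ` {d \<in> chords V. \<forall>e\<in>T. \<not> crosses d e} \<longleftrightarrow>
     T = {d \<in> chords V. \<forall>e\<in>T. \<not> crosses d e}"
    by (rule inj_on_image_eq_iff[OF inj T]) blast
  ultimately show ?thesis unfolding triang_def by simp
qed

text \<open>Chords and crossings are defined by comparisons alone, so an order isomorphism of vertex
  sets carries triangulations to triangulations.\<close>

lemma avoiding_empty_image:
  assumes h: "strict_mono_on V (h :: nat \<Rightarrow> nat)"
  shows "avoiding (h ` V) {} = avoiding V {}"
proof -
  have inj: "inj_on ((`) h) (chords V)"
    using inj_on_image_Pow[OF strict_mono_on_imp_inj_on[OF h]] chords_subset_Pow inj_on_subset by blast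
  have "bij_betw ((`) ((`) h)) {T. triang V T} {T. triang (h ` V) T}"
  proof (rule bij_betw_imageI)
    show "inj_on ((`) ((`) h)) {T. triang V T}"
      by (rule inj_on_subset[OF inj_on_image_Pow[OF inj]]) (auto dest: triang_subset)
    show "(`) ((`) h) ` {T. triang V T} = {T. triang (h ` V) T}"
    proof
      show "(`) ((`) h) ` {T. triang V T} \<subseteq> {T. triang (h ` V) T}"
        using triang_image[OF h] triang_subset by blast
      show "{T. triang (h ` V) T} \<subseteq> (`) ((`) h) ` {T. triang V T}"
      proof
        fix T assume T: "T \<in> {T. triang (h ` V) T}"
        then have "T \<subseteq> (`) h ` chords V" using triang_subset chords_image[OF h] by blast
        then obtain T' where "T' \<subseteq> chords V" "T = (`) h ` T'" by (auto simp: subset_image_iff)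
        then show "T \<in> (`) ((`) h) ` {T. triang V T}" using T triang_image[OF h] by blast
      qed
    qed
  qed
  then show ?thesis unfolding avoiding_def by (auto dest: bij_betw_same_card)
qed

text \<open>The Catalan numbers, indexed by the number \<open>m\<close> of triangles in a
  triangulation of the polygon with \<open>m + 2\<close> vertices.\<close>

definition num_triangs :: "nat \<Rightarrow> int" where
  "num_triangs m = avoiding {..<m + 2} {}"

lemma avoiding_empty:
  assumes "finite V" "card V = m + 2"
  shows "avoiding V {} = num_triangs m"
proof -
  obtain h where "bij_betw h {..<card V} V" "strict_mono_on {..<card V} h"
    using ex_bij_betw_strict_mono_card[OF assms(1)] .
  then show ?thesis
    using avoiding_empty_image[of "{..<card V}" h] assms(2)
    unfolding num_triangs_def by (simp add: bij_betw_imp_surj_on)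
qed

section \<open>Binary trees and their action on sequences\<close>

datatype btree = Leaf | Node btree btree

text \<open>A tree with \<open>k\<close> nodes is placed on the points \<open>i, \<dots>, i + k + 1\<close>; the root of a nonempty
  tree is the triangle resting on the segment from \<open>i\<close> to \<open>i + k + 1\<close>, and a leaf is a
  segment joining consecutive points, which is not recorded.\<close>

fun edges :: "nat \<Rightarrow> btree \<Rightarrow> nat set set" where
  "edges i Leaf = {}"
| "edges i (Node l r) = insert {i, i + size l + size r + 2} (edges i l \<union> edges (i + size l + 1) r)"

text \<open>Deleting the edge below a nonempty tree merges its root triangle into the cell below,
  which shifts the size of that cell; keeping it splits off a polygon.\<close>

fun act :: "btree \<Rightarrow> (nat \<Rightarrow> int) \<Rightarrow> nat \<Rightarrow> int" where
  "act Leaf f m = f m"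
| "act (Node l r) f m = act l (act r f) (m + 1) - act l (act r num_triangs) 1 * f m"

text \<open>Two laws satisfied by every polynomial in the shift operator. Each \<open>act t\<close>
  is such a polynomial: at a node it is the product of the operators of the subtrees and one shift,
  minus a scalar.\<close>

definition shift_linear :: "((nat \<Rightarrow> int) \<Rightarrow> nat \<Rightarrow> int) \<Rightarrow> bool" where
  "shift_linear L \<longleftrightarrow> (\<forall>f g c. L (\<lambda>m. f m - c * g m) = (\<lambda>m. L f m - c * L g m)) \<and>
     (\<forall>f. L (\<lambda>m. f (m + 1)) = (\<lambda>m. L f (m + 1)))"

section \<open>Tree operators commute\<close>

lemma act_Leaf: "act Leaf f = f"
  by (rule ext) simp

lemma act_Node: "act (Node l r) f = (\<lambda>m. act l (act r f) (m + 1) - act l (act r num_triangs) 1 * f m)"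
  by (rule ext) simp

lemma shift_linear_act: "shift_linear (act t)"
proof (induction t)
  case Leaf
  show ?case by (simp add: shift_linear_def act_Leaf)
next
  case (Node l r)
  have lin: "act t (\<lambda>m. f m - c * g m) = (\<lambda>m. act t f m - c * act t g m)"
    and sh: "act t (\<lambda>m. f (Suc m)) = (\<lambda>m. act t f (Suc m))"
    if "t \<in> {l, r}" for t f g c
    using Node that unfolding shift_linear_def by auto
  show ?case unfolding shift_linear_def act_Node by (simp add: lin sh algebra_simps)
qed

text \<open>\<open>act t\<close> is assembled from shifts, scalars and composition only, and a
  shift-linear \<open>L\<close> passes through each of these.\<close>

lemma act_commutes: "shift_linear L \<Longrightarrow> act t (L f) = L (act t f)"
proof (induction t arbitrary: f)
  case Leaf
  show ?case by (simp add: act_Leaf)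
next
  case (Node l r)
  have "L (\<lambda>m. act l (act r f) (m + 1) - c * f m) = (\<lambda>m. L (act l (act r f)) (m + 1) - c * L f m)" for c
    using Node.prems unfolding shift_linear_def by metis
  then show ?case unfolding act_Node using Node by simp
qed

lemma act_commute: "act s (act t f) = act t (act s f)"
  by (rule act_commutes[OF shift_linear_act])

lemma act_shift: "act t (\<lambda>k. f (k + m)) k = act t f (k + m)"
proof (induction m arbitrary: k f)
  case (Suc m)
  have "act t (\<lambda>k. g (k + 1)) = (\<lambda>k. act t g (k + 1))" for g
    using shift_linear_act[of t] unfolding shift_linear_def by blast
  from this[of "\<lambda>k. f (k + m)"] show ?case using Suc by simp
qed simp

text \<open>The value of a whole polygon whose root triangle carries \<open>l\<close> and
  \<open>r\<close>. The root side is never forbidden, so the root cell starts with one triangle,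
  whence the argument 1.\<close>

definition act_pair :: "btree \<Rightarrow> btree \<Rightarrow> int" where
  "act_pair l r = act l (act r num_triangs) 1"

lemma act_pair_commute: "act_pair l r = act_pair r l"
  unfolding act_pair_def by (simp add: act_commute)

text \<open>Both sides equal the expression
  \<open>act l (act r num_triangs) 2 - act l num_triangs 1 * act r num_triangs 1\<close>, symmetric in \<open>l\<close> and \<open>r\<close>:
  moving the root side of the polygon to a neighbouring triangle does not matter.\<close>

lemma act_pair_reroot: "act_pair (Node l Leaf) r = act_pair l (Node r Leaf)"
proof -
  have "act_pair (Node l Leaf) r = act l (act r num_triangs) 2 - act l num_triangs 1 * act r num_triangs 1" for l r
    unfolding act_pair_def act_Node act_Leaf by (simp add: numeral_2_eq_2)
  from this[of l r] this[of r l] show ?thesis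
    by (simp add: act_pair_commute[of l "Node r Leaf"] act_commute[of r l])
qed

text \<open>Swapping the subtrees of a node: both the composed operator and the subtracted scalar
  are symmetric since the operators commute.\<close>

lemma act_Node_commute: "act (Node l r) = act (Node r l)"
  by (intro ext) (simp add: act_commute[of l r])

section \<open>Triangulations avoiding the edges of a tree\<close>

lemma edges_subset: "e \<in> edges i t \<Longrightarrow> e \<subseteq> {i..i + size t + 1}"
  by (induction i t rule: edges.induct) force+

lemma edges_doubleton: "e \<in> edges i t \<Longrightarrow> \<exists>a b. a < b \<and> e = {a, b}"
proof (induction i t rule: edges.induct)
  case (2 i l r)
  have "i < i + size l + size r + 2" by simp
  with 2 show ?case unfolding edges.simps by blast
qed simp

lemma edges_interval:
  assumes "e \<in> edges i t"
  obtains a b where "e = {a, b}" "i \<le> a" "a < b" "b \<le> i + size t + 1"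
proof -
  obtain a b where "a < b" "e = {a, b}" using edges_doubleton[OF assms] by blast
  moreover have "{a, b} \<subseteq> {i..i + size t + 1}" using edges_subset[OF assms] calculation by simp
  ultimately show ?thesis using that by auto
qed

text \<open>The tree is attached to an outer polygon \<open>W\<close> along its base segment, and
  \<open>f k\<close> counts the triangulations avoiding \<open>S\<close> once \<open>k\<close> new
  vertices are placed over that segment. Arbitrary sets \<open>X\<close> occur because the subtrees
  are attached one after the other. The vertex of \<open>W\<close> beyond the interval makes the
  base a diagonal.\<close>

definition tree_counts :: "btree \<Rightarrow> bool" where
  "tree_counts t \<longleftrightarrow> (\<forall>i W S f. finite W \<longrightarrow> i \<in> W \<longrightarrow> i + size t + 1 \<in> W \<longrightarrow>
     W \<inter> {i<..<i + size t + 1} = {} \<longrightarrow> \<not> W \<subseteq> {i..i + size t + 1} \<longrightarrow>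
     (\<forall>e\<in>S. \<not> e \<subseteq> {i..i + size t + 1}) \<longrightarrow>
     (\<forall>X. X \<subseteq> {i<..<i + size t + 1} \<longrightarrow> avoiding (W \<union> X) S = f (card X)) \<longrightarrow>
     avoiding (W \<union> {i<..<i + size t + 1}) (S \<union> edges i t) = act t f 0)"

text \<open>As long as the base \<open>{i, j}\<close> is not forbidden, the triangle on
  \<open>i\<close>, \<open>m\<close>, \<open>j\<close> belongs to the outer cell, and its apex
  \<open>m\<close> contributes the argument 1. The subtrees are attached in turn, first
  \<open>r\<close>, then \<open>l\<close>.\<close>

lemma avoiding_pair:
  assumes l: "tree_counts l" and r: "tree_counts r"
    and m: "m = i + size l + 1" and j: "j = m + size r + 1"
    and W: "finite W" "i \<in> W" "j \<in> W" "W \<inter> {i<..<j} = {}"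
    and S: "\<forall>e\<in>S. \<not> e \<subseteq> {i..j}"
    and f: "\<And>X. X \<subseteq> {i<..<j} \<Longrightarrow> avoiding (W \<union> X) S = f (card X)"
  shows "avoiding (W \<union> {i<..<j}) (S \<union> edges i l \<union> edges m r) = act l (act r f) 1"
proof -
  have right: "avoiding (W \<union> insert m X \<union> {m<..<j}) (S \<union> edges m r) = act r f (card X + 1)"
    if X: "X \<subseteq> {i<..<m}" for X
  proof -
    have fX: "finite X" using X finite_subset by blast
    have "avoiding (W \<union> insert m X \<union> {m<..<j}) (S \<union> edges m r) = act r (\<lambda>k. f (k + (card X + 1))) 0"
      unfolding j
    proof (rule r[unfolded tree_counts_def, rule_format])
      show "finite (W \<union> insert m X)" using W fX by simp
      show "m \<in> W \<union> insert m X" "m + size r + 1 \<in> W \<union> insert m X" using W j by auto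
      show "(W \<union> insert m X) \<inter> {m<..<m + size r + 1} = {}" using W X m j by auto
      show "\<not> W \<union> insert m X \<subseteq> {m..m + size r + 1}" using W m by auto
      show "\<not> e \<subseteq> {m..m + size r + 1}" if "e \<in> S" for e
      proof -
        have "{m..m + size r + 1} \<subseteq> {i..j}" using m j by auto
        then show ?thesis using S that by blast
      qed
      show "avoiding (W \<union> insert m X \<union> Y) S = f (card Y + (card X + 1))"
        if Y: "Y \<subseteq> {m<..<m + size r + 1}" for Y
      proof -
        have fY: "finite Y" using Y finite_subset by blast
        have "{i<..<m} \<inter> {m<..<m + size r + 1} = {}" by auto
        then have "X \<inter> Y = {}" using X Y by blast
        moreover have "m \<notin> X \<union> Y" using X Y by auto
        ultimately have "card (insert m X \<union> Y) = card Y + (card X + 1)"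
          using fX fY by (simp add: card_Un_disjoint)
        moreover have "insert m X \<union> Y \<subseteq> {i<..<j}" using X Y m j by auto
        ultimately show ?thesis using f[of "insert m X \<union> Y"] by (simp add: Un_assoc)
      qed
    qed
    then show ?thesis using act_shift[of r f "card X + 1" 0] by simp
  qed
  have "avoiding (W \<union> insert m {m<..<j} \<union> {i<..<m}) (S \<union> edges m r \<union> edges i l)
    = act l (\<lambda>k. act r f (k + 1)) 0"
    unfolding m
  proof (rule l[unfolded tree_counts_def, rule_format], fold m)
    show "finite (W \<union> insert m {m<..<j})" using W by simp
    show "i \<in> W \<union> insert m {m<..<j}" "m \<in> W \<union> insert m {m<..<j}" using W by auto
    show "(W \<union> insert m {m<..<j}) \<inter> {i<..<m} = {}" using W m j by auto
    show "\<not> W \<union> insert m {m<..<j} \<subseteq> {i..m}" using W j by auto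
    show "\<not> e \<subseteq> {i..m}" if "e \<in> S \<union> edges m r" for e
      using that
    proof
      assume "e \<in> S"
      moreover have "{i..m} \<subseteq> {i..j}" using j by auto
      ultimately show ?thesis using S by blast
    next
      assume "e \<in> edges m r"
      then show ?thesis by (rule edges_interval) auto
    qed
    show "avoiding (W \<union> insert m {m<..<j} \<union> X) (S \<union> edges m r) = act r f (card X + 1)"
      if "X \<subseteq> {i<..<m}" for X
    proof -
      have "W \<union> insert m {m<..<j} \<union> X = W \<union> insert m X \<union> {m<..<j}" by blast
      then show ?thesis using right[OF that] by simp
    qed
  qed
  moreover have "W \<union> insert m {m<..<j} \<union> {i<..<m} = W \<union> {i<..<j}" using m j by auto
  moreover have "S \<union> edges m r \<union> edges i l = S \<union> edges i l \<union> edges m r" by blast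
  ultimately show ?thesis using act_shift[of l "act r f" 1 0] by simp
qed

text \<open>Here the outer polygon degenerates to the root side: \<open>k\<close> points added to
  \<open>{i, j}\<close> form a polygon with \<open>k + 2\<close> vertices, so the sequence is
  \<open>num_triangs\<close>.\<close>

lemma avoiding_polygon_pair:
  assumes l: "tree_counts l" and r: "tree_counts r"
    and m: "m = i + size l + 1" and j: "j = m + size r + 1"
  shows "avoiding {i..j} (edges i l \<union> edges m r) = act_pair l r"
proof -
  have "avoiding ({i, j} \<union> {i<..<j}) ({} \<union> edges i l \<union> edges m r) = act l (act r num_triangs) 1"
  proof (rule avoiding_pair[OF l r m j])
    fix X assume X: "X \<subseteq> {i<..<j}"
    then have "finite X" "i \<notin> X" "j \<notin> X" using finite_subset by auto
    then have "card ({i, j} \<union> X) = card X + 2" using m j by simp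
    then show "avoiding ({i, j} \<union> X) {} = num_triangs (card X)"
      using \<open>finite X\<close> by (intro avoiding_empty) auto
  qed auto
  moreover have "{i, j} \<union> {i<..<j} = {i..j}" using m j by auto
  ultimately show ?thesis by (simp add: act_pair_def)
qed

text \<open>Deletion-contraction at the base: deleting it leaves the situation of
  \<open>avoiding_pair\<close>; using it leaves the polygon over the base, counted by
  \<open>act_pair\<close>, and the outer polygon \<open>W\<close>, counted by \<open>f 0\<close>.
  This is the recursion of \<open>act\<close>.\<close>

lemma tree_counts: "tree_counts t"
proof (induction t)
  case Leaf
  have "{i<..<Suc i} = {}" for i :: nat by auto
  then show ?case unfolding tree_counts_def by (force simp: act_Leaf)
next
  case (Node l r)
  show ?case unfolding tree_counts_def
  proof (intro allI impI)
    fix i W S f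
    define m where m: "m = i + size l + 1"
    define j where j: "j = m + size r + 1"
    have sz: "i + size (Node l r) + 1 = j" using m j by simp
    assume "finite W" "i \<in> W" "i + size (Node l r) + 1 \<in> W"
      "W \<inter> {i<..<i + size (Node l r) + 1} = {}" "\<not> W \<subseteq> {i..i + size (Node l r) + 1}"
      "\<forall>e\<in>S. \<not> e \<subseteq> {i..i + size (Node l r) + 1}"
      "\<forall>X. X \<subseteq> {i<..<i + size (Node l r) + 1} \<longrightarrow> avoiding (W \<union> X) S = f (card X)"
    then have W: "finite W" "i \<in> W" "j \<in> W" "W \<inter> {i<..<j} = {}" "\<not> W \<subseteq> {i..j}"
      and S: "\<forall>e\<in>S. \<not> e \<subseteq> {i..j}"
      and f: "\<And>X. X \<subseteq> {i<..<j} \<Longrightarrow> avoiding (W \<union> X) S = f (card X)"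
      unfolding sz by blast+
    let ?V = "W \<union> {i<..<j}" and ?S = "S \<union> edges i l \<union> edges m r"
    have ij: "i < m" "m < j" using m j by auto
    have inner: "e \<notin> chords W \<and> e \<noteq> {i, j} \<and> e \<subseteq> {i..j}" if "e \<in> edges i l \<union> edges m r" for e
    proof -
      obtain a b where ab: "e = {a, b}" "i \<le> a" "a < b" "b \<le> j" "b \<le> m \<or> m \<le> a"
        using \<open>e \<in> edges i l \<union> edges m r\<close>
      proof
        assume "e \<in> edges i l"
        then show thesis by (rule edges_interval) (rule that, use m ij in auto)
      next
        assume "e \<in> edges m r"
        then show thesis by (rule edges_interval) (rule that, use j ij in auto)
      qed
      have "e \<notin> chords W"
      proof
        assume "e \<in> chords W"
        then have "a \<in> W" "b \<in> W" using ab chords_iff by auto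
        then have "a \<notin> {i<..<j}" "b \<notin> {i<..<j}" using W by auto
        then show False using ab ij by auto
      qed
      then show ?thesis using ab ij by (auto simp: doubleton_eq_iff)
    qed
    \<comment> \<open>The apex \<open>m\<close> lies on one side of the base, a vertex of
      \<open>W\<close> outside \<open>{i..j}\<close> on the other.\<close>
    have ch: "{i, j} \<in> chords ?V"
      using W ij by (subst chords_iff) (auto simp: not_le intro: bexI[of _ m])
    have nS: "{i, j} \<notin> ?S" using inner S ij by auto
    have "avoiding ?V (insert {i, j} ?S) =
        avoiding ?V ?S - avoiding (?V \<inter> {i..j}) ?S * avoiding (?V - {i<..<j}) ?S"
      using W ij ch nS by (intro avoiding_insert) auto
    also have "avoiding ?V ?S = act l (act r f) 1"
      using avoiding_pair[OF Node m j W(1-4) S f] .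
    also have "?V \<inter> {i..j} = {i..j}" using W(2,3) le_neq_implies_less by auto
    also have "avoiding {i..j} ?S = avoiding {i..j} (edges i l \<union> edges m r)"
      using S chords_subset_Pow[of "{i..j}"] by (intro avoiding_cong) blast
    also have "\<dots> = act l (act r num_triangs) 1"
      using avoiding_polygon_pair[OF Node m j] by (simp add: act_pair_def)
    also have "?V - {i<..<j} = W" using W by blast
    also have "avoiding W ?S = avoiding W S"
      using inner by (intro avoiding_cong) blast
    also have "avoiding W S = f 0" using f[of "{}"] by simp
    finally have "avoiding ?V (insert {i, j} ?S) = act (Node l r) f 0" by simp
    moreover have "S \<union> edges i (Node l r) = insert {i, j} ?S" using m j by auto
    ultimately show "avoiding (W \<union> {i<..<i + size (Node l r) + 1}) (S \<union> edges i (Node l r)) = act (Node l r) f 0"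
      unfolding sz by simp
  qed
qed

section \<open>Internal triangles\<close>

text \<open>A node with two nonempty children has a triangle whose three sides are all recorded
  edges, its own base included; it is an internal triangle whenever the base is a diagonal.\<close>

fun branching :: "btree \<Rightarrow> bool" where
  "branching Leaf = False"
| "branching (Node l r) = (l \<noteq> Leaf \<and> r \<noteq> Leaf)"

fun branchings :: "nat \<Rightarrow> btree \<Rightarrow> nat set set" where
  "branchings i Leaf = {}"
| "branchings i (Node l r) =
     (if branching (Node l r) then {{i, i + size l + 1, i + size l + size r + 2}} else {})
     \<union> branchings i l \<union> branchings (i + size l + 1) r"

section \<open>Location of the branching triangles\<close>

lemma branchings_interval:
  assumes "x \<in> branchings i t"
  obtains a b c where "x = {a, b, c}" "i \<le> a" "a < b" "b < c" "c \<le> i + size t + 1"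
proof -
  have "\<exists>a b c. x = {a, b, c} \<and> i \<le> a \<and> a < b \<and> b < c \<and> c \<le> i + size t + 1"
    using assms
  proof (induction i t rule: branchings.induct)
    case (2 i l r)
    then consider "x = {i, i + size l + 1, i + size l + size r + 2}"
      | "x \<in> branchings i l" | "x \<in> branchings (i + size l + 1) r"
      by (auto split: if_splits)
    then show ?case
    proof cases
      case 1
      then show ?thesis by (intro exI[of _ i] exI[of _ "i + size l + 1"] exI[of _ "i + size l + size r + 2"]) simp
    next
      case 2
      with "2.IH"(1) obtain a b c where "x = {a, b, c} \<and> i \<le> a \<and> a < b \<and> b < c \<and> c \<le> i + size l + 1" by blast
      then show ?thesis by (intro exI[of _ a] exI[of _ b] exI[of _ c]) simp
    next
      case 3
      with "2.IH"(2) obtain a b c where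
        "x = {a, b, c} \<and> i + size l + 1 \<le> a \<and> a < b \<and> b < c \<and> c \<le> i + size l + 1 + size r + 1" by blast
      then show ?thesis by (intro exI[of _ a] exI[of _ b] exI[of _ c]) simp
    qed
  qed simp
  then show thesis using that by blast
qed

lemma branchings_subset: "x \<in> branchings i t \<Longrightarrow> x \<subseteq> {i..i + size t + 1}"
  by (erule branchings_interval) auto

text \<open>Three distinct vertices cannot lie on both sides of a single point \<open>j\<close>.
  This allows two families separated by \<open>j\<close> to be recovered from their union.\<close>

lemma branchings_separated:
  assumes "x \<in> branchings i l" "i + size l + 1 \<le> j"
  shows "x \<subseteq> {..j}" "\<not> x \<subseteq> {j..}"
  using assms by (auto elim!: branchings_interval)

lemma branchings_separated':
  assumes "x \<in> branchings j r"
  shows "x \<subseteq> {j..}" "\<not> x \<subseteq> {..j}"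
  using assms by (auto elim!: branchings_interval)

lemma branchings_left:
  assumes "i + size l + 1 \<le> j"
  shows "{x \<in> branchings i l \<union> branchings j r. x \<subseteq> {..j}} = branchings i l"
  using branchings_separated(1)[OF _ assms] branchings_separated'(2)[of _ j r] by auto

lemma branchings_right:
  assumes "i + size l + 1 \<le> j"
  shows "{x \<in> branchings i l \<union> branchings j r. x \<subseteq> {j..}} = branchings j r"
  using branchings_separated(2)[OF _ assms] branchings_separated'(1)[of _ j r] by auto

text \<open>A non-branching node has an empty child, and commutation puts the other child on the
  left. Such a node is a link of a chain: it adds one to the size and no branching triangle.\<close>

lemma branching_chain:
  assumes "\<not> branching (Node l r)"
  obtains s k where "s \<in> {l, r}" "act (Node l r) = act (Node s Leaf)" "size s = size l + size r"
    "branchings i (Node l r) = branchings k s" "i \<le> k" "k + size s \<le> i + size l + size r + 1"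
proof (cases "r = Leaf")
  case True
  then show ?thesis using that[of l i] by auto
next
  case False
  then have "l = Leaf" using assms by simp
  then show ?thesis using that[of r "i + 1"] act_Node_commute[of l r] by auto
qed

lemma branching_root:
  assumes "branching t"
  obtains m where "{i, m, i + size t + 1} \<in> branchings i t" "i < m" "m < i + size t + 1"
proof -
  obtain l r where "t = Node l r" "l \<noteq> Leaf" "r \<noteq> Leaf" using assms by (cases t) auto
  then show thesis using that[of "i + size l + 1"] by (simp add: add.assoc)
qed

text \<open>The root triangle of a branching tree is recognised as the internal triangle of maximal width.\<close>

lemma act_eqI:
  "size t1 = size t2 \<Longrightarrow> branchings i t1 = branchings j t2 \<Longrightarrow> act t1 = act t2"
proof (induction t1 arbitrary: i j t2)
  case Leaf
  then show ?case by (cases t2) auto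
next
  case (Node l1 r1)
  then obtain l2 r2 where t2: "t2 = Node l2 r2" by (cases t2) auto
  \<comment> \<open>The root triangle of a branching tree spans its whole interval, which is too
    wide for a tree of smaller size.\<close>
  have narrow: False
    if b: "branching t" and s: "size s < size t" and eq: "branchings p t = branchings k s" for p k s t
  proof -
    obtain m where "{p, m, p + size t + 1} \<in> branchings p t" using branching_root[OF b] by blast
    with branchings_subset[of _ k s] eq have "{p, m, p + size t + 1} \<subseteq> {k..k + size s + 1}" by blast
    then show False using s by simp
  qed
  show ?case
  proof (cases "branching (Node l1 r1)")
    case b1: False
    obtain s1 k1 where s1: "s1 \<in> {l1, r1}" "act (Node l1 r1) = act (Node s1 Leaf)"
      "size s1 = size l1 + size r1" "branchings i (Node l1 r1) = branchings k1 s1"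
      "i \<le> k1" "k1 + size s1 \<le> i + size l1 + size r1 + 1"
      by (rule branching_chain[OF b1, of i])
    have b2: "\<not> branching (Node l2 r2)"
      using narrow[of "Node l2 r2" s1 j k1] s1 Node.prems t2 by auto
    obtain s2 k2 where s2: "s2 \<in> {l2, r2}" "act (Node l2 r2) = act (Node s2 Leaf)"
      "size s2 = size l2 + size r2" "branchings j (Node l2 r2) = branchings k2 s2"
      "j \<le> k2" "k2 + size s2 \<le> j + size l2 + size r2 + 1"
      by (rule branching_chain[OF b2, of j])
    have "size s1 = size s2" "branchings k1 s1 = branchings k2 s2"
      using s1 s2 Node.prems t2 by auto
    then have "act s1 = act s2" using Node.IH s1(1) by blast
    then have "act (Node s1 Leaf) = act (Node s2 Leaf)" by (intro ext) simp
    then show ?thesis using s1 s2 t2 by simp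
  next
    case b1: True
    have b2: "branching (Node l2 r2)"
    proof (rule ccontr)
      assume b2: "\<not> ?thesis"
      obtain s2 k2 where "s2 \<in> {l2, r2}" "act (Node l2 r2) = act (Node s2 Leaf)"
        "size s2 = size l2 + size r2" "branchings j (Node l2 r2) = branchings k2 s2"
        "j \<le> k2" "k2 + size s2 \<le> j + size l2 + size r2 + 1"
        by (rule branching_chain[OF b2, of j])
      then show False using narrow[OF b1, of s2 i k2] Node.prems t2 by auto
    qed
    let ?U = "branchings i (Node l1 r1)"
    define m1 where m1: "m1 = i + size l1 + 1"
    define m2 where m2: "m2 = i + size l2 + 1"
    define e where e: "e = i + size l1 + size r1 + 2"
    have sz: "size l1 + size r1 = size l2 + size r2" using Node.prems t2 by simp
    have "{i, m1, e} \<in> ?U"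
      using b1 by (simp add: m1 e)
    moreover have "{j, j + size l2 + 1, j + size l2 + size r2 + 2} \<in> ?U"
      unfolding Node.prems(2) t2 using b2 by simp
    \<comment> \<open>Each root triangle belongs to the common family and so lies in the interval of
      the other tree; hence the left ends agree.\<close>
    ultimately have "i \<in> {j..j + size t2 + 1}" "j \<in> {i..i + size (Node l1 r1) + 1}"
      using branchings_subset[of _ i "Node l1 r1"] branchings_subset[of _ j t2] Node.prems(2) by blast+
    then have ij: "j = i" by simp
    have U1: "?U = insert {i, m1, e} (branchings i l1 \<union> branchings m1 r1)"
      using b1 by (auto simp: m1 e)
    have U2: "?U = insert {i, m2, e} (branchings i l2 \<union> branchings m2 r2)"
      using b2 Node.prems(2) sz unfolding t2 ij by (auto simp: m2 e)
    have le: "m1 < e" "m2 < e" "i < m1" "i < m2" using sz m1 m2 e by auto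
    \<comment> \<open>A triangle reaching from \<open>i\<close> to \<open>e\<close> fits into
      neither subtree of the second tree, so it must be the root there as well, which identifies the
      apexes.\<close>
    have "{i, m1, e} \<notin> branchings i l2" using branchings_subset[of "{i, m1, e}" i l2] le m2 by auto
    moreover have "{i, m1, e} \<notin> branchings m2 r2"
      using branchings_subset[of "{i, m1, e}" m2 r2] le by auto
    moreover have "{i, m1, e} \<in> insert {i, m2, e} (branchings i l2 \<union> branchings m2 r2)"
      unfolding U2[symmetric] U1 by (rule insertI1)
    ultimately have "{i, m1, e} = {i, m2, e}" by simp
    then have "m1 \<in> {i, m2, e}" by (metis insertI1 insertI2)
    then have mm: "m2 = m1" using le by auto
    \<comment> \<open>The common apex separates the families of the two subtrees, so each is
      determined by the union.\<close>
    have "branchings i l1 = {x \<in> ?U. x \<subseteq> {..m1}}"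
      unfolding U1 using branchings_left[of i l1 m1 r1] m1 le by auto
    moreover have "branchings i l2 = {x \<in> ?U. x \<subseteq> {..m1}}"
      unfolding U2 mm using branchings_left[of i l2 m1 r2] m2 mm le by auto
    moreover have "size l1 = size l2" using m1 m2 mm by simp
    ultimately have l: "act l1 = act l2" using Node.IH(1)[of l2 i i] by simp
    have "branchings m1 r1 = {x \<in> ?U. x \<subseteq> {m1..}}"
      unfolding U1 using branchings_right[of i l1 m1 r1] m1 le by auto
    moreover have "branchings m1 r2 = {x \<in> ?U. x \<subseteq> {m1..}}"
      unfolding U2 mm using branchings_right[of i l2 m1 r2] m2 mm le by auto
    moreover have "size r1 = size r2" using m1 m2 mm sz by simp
    ultimately have r: "act r1 = act r2" using Node.IH(2)[of r2 m1 m1] by simp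
    show ?thesis unfolding t2 by (intro ext) (simp add: l r)
  qed
qed

section \<open>Normal forms of rooted polygons under rerooting\<close>

text \<open>Rerooting moves a chain node from the top of \<open>l\<close> to the top of
  \<open>r\<close> without changing the branching triangles, until \<open>l\<close> is empty or
  branches. The two intervals then need no longer meet, which is why the position condition is an
  inequality.\<close>

lemma act_pair_normalize_left:
  assumes "i + size l + 1 \<le> j"
  shows "\<exists>i' l' r'. (l' = Leaf \<or> branching l') \<and> act_pair l r = act_pair l' r' \<and>
    size l' + size r' = size l + size r \<and> i' + size l' + 1 \<le> j \<and>
    branchings i' l' = branchings i l \<and> branchings j r' = branchings j r"
  using assms
proof (induction "size l" arbitrary: i l r rule: less_induct)
  case less
  show ?case
  proof (cases "l = Leaf \<or> branching l")
    case True
    then show ?thesis using less.prems by blast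
  next
    case False
    then obtain a b where l: "l = Node a b" and b: "\<not> branching (Node a b)" by (cases l) auto
    obtain s k where s: "s \<in> {a, b}" "act (Node a b) = act (Node s Leaf)" "size s = size a + size b"
      "branchings i (Node a b) = branchings k s" "i \<le> k" "k + size s \<le> i + size a + size b + 1"
      by (rule branching_chain[OF b, of i])
    have "act_pair l r = act_pair s (Node r Leaf)"
      using s(2) act_pair_reroot[of s r] unfolding l by (simp add: act_pair_def)
    moreover have "size s < size l" "k + size s + 1 \<le> j" using s l less.prems by auto
    moreover note less.hyps[of s k "Node r Leaf"]
    ultimately show ?thesis using s l by auto
  qed
qed

text \<open>A tree without branching triangles is a chain, and rerooting moves its nodes one at a
  time over to \<open>l\<close>.\<close>

lemma act_pair_absorb_right:
  assumes "branchings j r = {}"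
  shows "\<exists>l'. act_pair l r = act_pair l' Leaf \<and> size l' = size l + size r \<and>
    branchings i l' = branchings i l"
  using assms
proof (induction "size r" arbitrary: j l r rule: less_induct)
  case less
  show ?case
  proof (cases r)
    case Leaf
    then show ?thesis by auto
  next
    case (Node a b)
    then have nb: "\<not> branching (Node a b)" using less.prems by (auto split: if_splits)
    obtain s k where s: "s \<in> {a, b}" "act (Node a b) = act (Node s Leaf)" "size s = size a + size b"
      "branchings j (Node a b) = branchings k s" "j \<le> k" "k + size s \<le> j + size a + size b + 1"
      by (rule branching_chain[OF nb, of j])
    have "act_pair l r = act_pair (Node l Leaf) s"
      using s(2) act_pair_reroot[of l s] unfolding Node by (simp add: act_pair_def)
    moreover have "size s < size r" "branchings k s = {}" using s Node less.prems by auto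
    moreover note less.hyps[of s k "Node l Leaf"]
    ultimately show ?thesis using s Node by auto
  qed
qed

text \<open>Descending the chain from the root leads to a topmost branching node, whose triangle
  spans all the others.\<close>

lemma branchings_widest:
  assumes "branchings i t \<noteq> {}"
  shows "\<exists>x\<in>branchings i t. \<exists>a\<in>x. \<exists>c\<in>x. \<forall>y\<in>branchings i t. y \<subseteq> {a..c}"
  using assms
proof (induction "size t" arbitrary: i t rule: less_induct)
  case less
  show ?case
  proof (cases "branching t")
    case True
    then obtain m where m: "{i, m, i + size t + 1} \<in> branchings i t" by (rule branching_root)
    have "\<forall>y\<in>branchings i t. y \<subseteq> {i..i + size t + 1}"
      using branchings_subset by blast
    then show ?thesis
      by (intro bexI[OF _ m] bexI[of _ i] bexI[of _ "i + size t + 1"]) simp_all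
  next
    case False
    then obtain a b where t: "t = Node a b" and b: "\<not> branching (Node a b)"
      using less.prems by (cases t) auto
    obtain s k where s: "s \<in> {a, b}" "act (Node a b) = act (Node s Leaf)" "size s = size a + size b"
      "branchings i (Node a b) = branchings k s" "i \<le> k" "k + size s \<le> i + size a + size b + 1"
      by (rule branching_chain[OF b, of i])
    have "size s < size t" using s(3) by (simp add: t)
    moreover have "branchings k s \<noteq> {}" using less.prems unfolding t s(4) .
    ultimately have "\<exists>x\<in>branchings k s. \<exists>a\<in>x. \<exists>c\<in>x. \<forall>y\<in>branchings k s. y \<subseteq> {a..c}"
      by (rule less.hyps)
    then show ?thesis unfolding t s(4) .
  qed
qed

text \<open>The family of the single tree \<open>r1\<close> has a triangle spanning all others. Two
  nonempty families separated by \<open>j\<close> have none, so \<open>r\<close> is a chain; once it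
  is absorbed into \<open>l\<close>, \<open>act_eqI\<close> compares two single trees.\<close>

lemma act_pair_eq_Leaf:
  assumes U: "branchings j1 r1 = branchings i l \<union> branchings j r"
    and size: "size r1 = size l + size r" and ij: "i + size l + 1 \<le> j" and l: "branching l"
  shows "act_pair Leaf r1 = act_pair l r"
proof -
  have lne: "branchings i l \<noteq> {}" using branching_root[OF l, of i] by blast
  have "branchings j r = {}"
  proof (rule ccontr)
    assume rne: "branchings j r \<noteq> {}"
    obtain x a c where x: "x \<in> branchings i l \<union> branchings j r" "a \<in> x" "c \<in> x"
      and w: "\<forall>y\<in>branchings i l \<union> branchings j r. y \<subseteq> {a..c}"
      using branchings_widest[of j1 r1] lne unfolding U by blast
    from x(1) show False
    proof
      assume "x \<in> branchings i l"
      then have "c \<le> j" using branchings_separated(1)[OF _ ij] x by blast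
      moreover obtain y where y: "y \<in> branchings j r" using rne by blast
      moreover have "y \<subseteq> {a..c}" using w y by blast
      ultimately show False using branchings_separated'(2)[OF y] by auto
    next
      assume "x \<in> branchings j r"
      then have "j \<le> a" using branchings_separated'(1) x by blast
      moreover obtain y where y: "y \<in> branchings i l" using lne by blast
      moreover have "y \<subseteq> {a..c}" using w y by blast
      ultimately show False using branchings_separated(2)[OF y ij] by auto
    qed
  qed
  moreover obtain l' where l': "act_pair l r = act_pair l' Leaf" "size l' = size l + size r"
    "branchings i l' = branchings i l"
    using act_pair_absorb_right[OF calculation] by blast
  ultimately have "act r1 = act l'" using U size by (intro act_eqI[of _ _ j1 i]) auto
  then show ?thesis using l' act_pair_commute[of Leaf r1] by (simp add: act_pair_def)
qed

lemma act_pair_eq_normalized: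
  assumes U: "branchings i1 l1 \<union> branchings j1 r1 = branchings i2 l2 \<union> branchings j2 r2"
    and size: "size l1 + size r1 = size l2 + size r2"
    and ij: "i1 + size l1 + 1 \<le> j1" "i2 + size l2 + 1 \<le> j2"
    and n: "l1 = Leaf \<or> branching l1" "l2 = Leaf \<or> branching l2"
  shows "act_pair l1 r1 = act_pair l2 r2"
proof -
  consider "l1 = Leaf" "l2 = Leaf" | "l1 = Leaf" "branching l2" | "branching l1" "l2 = Leaf"
    | "branching l1" "branching l2" using n by blast
  then show ?thesis
  proof cases
    case 1
    then have "act r1 = act r2" using U size by (intro act_eqI[of _ _ j1 j2]) auto
    then show ?thesis using 1 by (simp add: act_pair_def)
  next
    case 2
    then show ?thesis using U size ij by (auto intro!: act_pair_eq_Leaf[of j1 r1 i2 l2 j2 r2])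
  next
    case 3
    then show ?thesis using U size ij by (auto intro!: act_pair_eq_Leaf[of j2 r2 i1 l1 j1 r1, symmetric])
  next
    case 4
    \<comment> \<open>The root triangle of \<open>l\<close> begins at \<open>i\<close> and ends at
      \<open>i + size l + 1\<close>. It lies in \<open>l'\<close> or in \<open>r'\<close>, and in
      the latter case begins beyond \<open>i'\<close>. Applied in both directions, this equates the
      intervals of the two left trees.\<close>
    have root: "i' \<le> i \<and> (i' = i \<longrightarrow> size l \<le> size l')"
      if b: "branching l" and U: "branchings i l \<subseteq> branchings i' l' \<union> branchings j' r'"
        and ij: "i' + size l' + 1 \<le> j'" for i l i' l' j' r'
    proof -
      obtain m where m: "{i, m, i + size l + 1} \<in> branchings i l" using branching_root[OF b] by blast
      then consider "{i, m, i + size l + 1} \<in> branchings i' l'" | "{i, m, i + size l + 1} \<in> branchings j' r'"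
        using U by blast
      then show ?thesis
      proof cases
        case 1
        from branchings_subset[OF this] show ?thesis by auto
      next
        case 2
        from branchings_subset[OF this] show ?thesis using ij by auto
      qed
    qed
    have "branchings i1 l1 \<subseteq> branchings i2 l2 \<union> branchings j2 r2"
      "branchings i2 l2 \<subseteq> branchings i1 l1 \<union> branchings j1 r1" using U by blast+
    from root[OF 4(1) this(1) ij(2)] root[OF 4(2) this(2) ij(1)]
    have "i1 = i2" "size l1 = size l2" by auto
    \<comment> \<open>The common right end \<open>e\<close> of the left trees separates the left
      family from the right one in both unions.\<close>
    then obtain e where e: "i1 = i2" "size l1 = size l2" "e = i1 + size l1 + 1" "e \<le> j1" "e \<le> j2"
      using ij by auto
    have L1: "branchings i1 l1 = {x \<in> branchings i1 l1 \<union> branchings j1 r1. x \<subseteq> {..e}}"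
      using branchings_separated(1)[of _ i1 l1 e] branchings_separated'(2)[of _ j1 r1] e by fastforce
    have L2: "branchings i2 l2 = {x \<in> branchings i2 l2 \<union> branchings j2 r2. x \<subseteq> {..e}}"
      using branchings_separated(1)[of _ i2 l2 e] branchings_separated'(2)[of _ j2 r2] e by fastforce
    have "branchings i1 l1 = branchings i2 l2" by (subst L1, subst L2) (simp only: U)
    then have l: "act l1 = act l2" using e by (intro act_eqI[of _ _ i1 i2]) auto
    have R1: "branchings j1 r1 = {x \<in> branchings i1 l1 \<union> branchings j1 r1. x \<subseteq> {e..}}"
      using branchings_separated(2)[of _ i1 l1 e] branchings_separated'(1)[of _ j1 r1] e by fastforce
    have R2: "branchings j2 r2 = {x \<in> branchings i2 l2 \<union> branchings j2 r2. x \<subseteq> {e..}}"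
      using branchings_separated(2)[of _ i2 l2 e] branchings_separated'(1)[of _ j2 r2] e by fastforce
    have "branchings j1 r1 = branchings j2 r2" by (subst R1, subst R2) (simp only: U)
    then have r: "act r1 = act r2" using e size by (intro act_eqI[of _ _ j1 j2]) auto
    show ?thesis by (simp add: act_pair_def l r)
  qed
qed

lemma act_pair_eqI:
  assumes U: "branchings i1 l1 \<union> branchings j1 r1 = branchings i2 l2 \<union> branchings j2 r2"
    and size: "size l1 + size r1 = size l2 + size r2"
    and ij: "i1 + size l1 + 1 \<le> j1" "i2 + size l2 + 1 \<le> j2"
  shows "act_pair l1 r1 = act_pair l2 r2"
proof -
  obtain i1' l1' r1' where 1: "l1' = Leaf \<or> branching l1'" "act_pair l1 r1 = act_pair l1' r1'"
    "size l1' + size r1' = size l1 + size r1" "i1' + size l1' + 1 \<le> j1"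
    "branchings i1' l1' = branchings i1 l1" "branchings j1 r1' = branchings j1 r1"
    using act_pair_normalize_left[OF ij(1), of r1] by blast
  obtain i2' l2' r2' where 2: "l2' = Leaf \<or> branching l2'" "act_pair l2 r2 = act_pair l2' r2'"
    "size l2' + size r2' = size l2 + size r2" "i2' + size l2' + 1 \<le> j2"
    "branchings i2' l2' = branchings i2 l2" "branchings j2 r2' = branchings j2 r2"
    using act_pair_normalize_left[OF ij(2), of r2] by blast
  show ?thesis unfolding 1(2) 2(2)
    by (rule act_pair_eq_normalized[of i1' l1' j1 r1' i2' l2' j2 r2']) (use 1 2 U size in simp_all)
qed

section \<open>Triangulations as trees\<close>

text \<open>Internal triangles expressed through the edge set alone, without the sides of a polygon,
  so that the notion applies to the edges of a subtree.\<close>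

definition closed_triples :: "nat set set \<Rightarrow> nat set set" where
  "closed_triples T = {{a, b, c} | a b c. a < b \<and> b < c \<and> {a, b} \<in> T \<and> {b, c} \<in> T \<and> {a, c} \<in> T}"

lemma closed_triples_mono: "S \<subseteq> T \<Longrightarrow> closed_triples S \<subseteq> closed_triples T"
  unfolding closed_triples_def by blast

lemma edges_bounds:
  assumes "{a, b} \<in> edges i t"
  shows "i \<le> a" "b \<le> i + size t + 1"
  using edges_subset[OF assms] by auto

lemma edges_root: "t \<noteq> Leaf \<Longrightarrow> {i, i + size t + 1} \<in> edges i t"
  by (cases t) (auto simp: add.assoc)

text \<open>The longest side \<open>{a, c}\<close> lies on one side of \<open>m\<close>; the two
  shorter ones lie below it and cannot come from the other tree.\<close>

lemma closed_triples_pair: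
  assumes "m = i + size l + 1"
  shows "closed_triples (edges i l \<union> edges m r) = closed_triples (edges i l) \<union> closed_triples (edges m r)"
proof
  show "closed_triples (edges i l) \<union> closed_triples (edges m r) \<subseteq> closed_triples (edges i l \<union> edges m r)"
    by (simp add: closed_triples_mono)
  show "closed_triples (edges i l \<union> edges m r) \<subseteq> closed_triples (edges i l) \<union> closed_triples (edges m r)"
  proof
    fix x assume "x \<in> closed_triples (edges i l \<union> edges m r)"
    then obtain a b c where x: "x = {a, b, c}" "a < b" "b < c" and
      ab: "{a, b} \<in> edges i l \<union> edges m r" and bc: "{b, c} \<in> edges i l \<union> edges m r"
      and ac: "{a, c} \<in> edges i l \<union> edges m r" unfolding closed_triples_def by blast
    have L: "q \<le> m" if "{p, q} \<in> edges i l" for p q using edges_bounds(2)[OF that] assms by simp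
    have R: "m \<le> p" if "{p, q} \<in> edges m r" for p q using edges_bounds(1)[OF that] .
    show "x \<in> closed_triples (edges i l) \<union> closed_triples (edges m r)"
      using ac
    proof
      assume h: "{a, c} \<in> edges i l"
      have "{a, b} \<notin> edges m r" "{b, c} \<notin> edges m r" using R L[OF h] x by fastforce+
      then show ?thesis using ab bc h x unfolding closed_triples_def by blast
    next
      assume h: "{a, c} \<in> edges m r"
      have "{a, b} \<notin> edges i l" "{b, c} \<notin> edges i l" using L R[OF h] x by fastforce+
      then show ?thesis using ab bc h x unfolding closed_triples_def by blast
    qed
  qed
qed

text \<open>A closed triple using the base \<open>{i, j}\<close> takes one further side from each
  subtree; these can meet only at \<open>m\<close>, so both subtrees are nonempty. All other triples
  come from the subtrees.\<close>

lemma closed_triples_edges: "closed_triples (edges i t) = branchings i t"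
proof (induction t arbitrary: i)
  case Leaf
  show ?case by (simp add: closed_triples_def)
next
  case (Node l r)
  define m where m: "m = i + size l + 1"
  define j where j: "j = m + size r + 1"
  have le: "i < m" "m < j" using m j by auto
  have E: "edges i (Node l r) = insert {i, j} (edges i l \<union> edges m r)" by (simp add: m j)
  have B: "branchings i (Node l r) =
    (if branching (Node l r) then {{i, m, j}} else {}) \<union> branchings i l \<union> branchings m r" by (simp add: m j)
  have IH: "closed_triples (edges i l \<union> edges m r) = branchings i l \<union> branchings m r"
    using closed_triples_pair[OF m] Node by simp
  have L: "q \<le> m" if "{p, q} \<in> edges i l" for p q using edges_bounds(2)[OF that] m by simp
  have R: "m \<le> p" "q \<le> j" if "{p, q} \<in> edges m r" for p q using edges_bounds[OF that] j by auto
  show ?case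
  proof
    show "closed_triples (edges i (Node l r)) \<subseteq> branchings i (Node l r)"
    proof
      fix x assume "x \<in> closed_triples (edges i (Node l r))"
      then obtain a b c where x: "x = {a, b, c}" "a < b" "b < c" and
        ab: "{a, b} \<in> edges i (Node l r)" and bc: "{b, c} \<in> edges i (Node l r)"
        and ac: "{a, c} \<in> edges i (Node l r)" unfolding closed_triples_def by blast
      have bnd: "i \<le> a" "c \<le> j" using edges_bounds[OF ac] m j by auto
      have ab': "{a, b} \<in> edges i l \<union> edges m r" and bc': "{b, c} \<in> edges i l \<union> edges m r"
        using ab bc x bnd unfolding E by (auto simp: doubleton_eq_iff)
      show "x \<in> branchings i (Node l r)"
      proof (cases "{a, c} = {i, j}")
        case True
        then have [simp]: "a = i" "c = j" using x le by (auto simp: doubleton_eq_iff)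
        have "{a, b} \<in> edges i l" using ab' R(1)[of a b] le by auto
        moreover have "{b, c} \<in> edges m r" using bc' L[of b c] le by auto
        ultimately have "b = m" "l \<noteq> Leaf" "r \<noteq> Leaf" using L[of a b] R(1)[of b c] by auto
        then show ?thesis unfolding B x by simp
      next
        case False
        then have "{a, c} \<in> edges i l \<union> edges m r" using ac unfolding E by blast
        then have "x \<in> closed_triples (edges i l \<union> edges m r)"
          using ab' bc' x unfolding closed_triples_def by blast
        then show ?thesis unfolding IH B by blast
      qed
    qed
    have "{i, m, j} \<in> closed_triples (edges i (Node l r))" if "branching (Node l r)"
    proof -
      have "{i, m} \<in> edges i l" "{m, j} \<in> edges m r"
        using that edges_root[of l i] edges_root[of r m] m j by auto
      then show ?thesis using le unfolding closed_triples_def E by blast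
    qed
    moreover have "branchings i l \<union> branchings m r \<subseteq> closed_triples (edges i (Node l r))"
      unfolding IH[symmetric] E by (rule closed_triples_mono) blast
    ultimately show "branchings i (Node l r) \<subseteq> closed_triples (edges i (Node l r))"
      unfolding B by auto
  qed
qed

text \<open>The apex of the triangle resting on the base segment is the last neighbour of \<open>i\<close> before \<open>j\<close>.\<close>

lemma triang_apex:
  assumes T: "triang {i..j} T" and ij: "i + 1 < j"
  obtains m where "i < m" "m < j" "\<forall>e\<in>T. \<not> crosses {i, m} e" "\<forall>e\<in>T. \<not> crosses {m, j} e"
proof -
  define M where "M = {m. m < j \<and> (m = i + 1 \<or> i < m \<and> {i, m} \<in> T)}"
  define m where "m = Max M"
  have fM: "finite M" by (rule finite_subset[of _ "{..<j}"]) (auto simp: M_def)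
  have "i + 1 \<in> M" using ij by (simp add: M_def)
  then have "m \<in> M" unfolding m_def using fM Max_in by blast
  then have m: "i < m" "m < j" "m = i + 1 \<or> {i, m} \<in> T" by (auto simp: M_def)
  have max: "q \<le> m" if "i < q" "q < j" "{i, q} \<in> T" for q
    unfolding m_def using fM that by (intro Max_ge) (auto simp: M_def)
  have T': "\<exists>p q. e = {p, q} \<and> i \<le> p \<and> p < q \<and> q \<le> j" if "e \<in> T" for e
  proof -
    have "e \<in> chords {i..j}" using T that triang_subset by blast
    then show ?thesis by (elim chordsE) (metis atLeastAtMost_iff)
  qed
  have left: "\<forall>e\<in>T. \<not> crosses {i, m} e"
  proof (cases "{i, m} \<in> T")
    case True
    then show ?thesis using triangD[OF T] by blast
  next
    case False
    then have "m = i + 1" using m by blast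
    then show ?thesis using T' m by (fastforce simp: crosses_iff)
  qed
  moreover have "\<forall>e\<in>T. \<not> crosses {m, j} e"
  proof
    fix e assume e: "e \<in> T"
    then obtain p q where pq: "e = {p, q}" "i \<le> p" "p < q" "q \<le> j" using T' by blast
    have "\<not> (i < p \<and> p < m \<and> m < q)" using left e pq m by (auto simp: crosses_iff)
    moreover have "\<not> (p = i \<and> m < q \<and> q < j)" using max[of q] e pq(1) m by fastforce
    ultimately show "\<not> crosses {m, j} e" using pq m by (auto simp: crosses_iff)
  qed
  ultimately show thesis using that m by blast
qed

text \<open>Induction on the length, cutting at the apex over the base. The base is a side of the
  polygon, hence not in \<open>T\<close>, but \<open>edges\<close> records it for a nonempty tree;
  this explains the inserted pair.\<close>

lemma triang_interval_tree:
  assumes "triang {i..j} T" "i < j"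
  shows "\<exists>t. j = i + size t + 1 \<and> edges i t = (if j = i + 1 then {} else insert {i, j} T)"
  using assms
proof (induction "j - i" arbitrary: i j T rule: less_induct)
  case less
  note T = less.prems(1)
  show ?case
  proof (cases "j = i + 1")
    case True
    then show ?thesis by (intro exI[of _ Leaf]) simp
  next
    case False
    then obtain m where m: "i < m" "m < j" and nl: "\<forall>e\<in>T. \<not> crosses {i, m} e"
      and nr: "\<forall>e\<in>T. \<not> crosses {m, j} e"
      using triang_apex[OF T] less.prems(2) by (metis Suc_eq_plus1 Suc_lessI)
    have I: "{i..j} \<inter> {i..m} = {i..m}" "{i..j} \<inter> {m..j} = {m..j}" using m by auto
    have "triang {i..m} (T \<inter> chords {i..m})"
      using triang_restrict_left[OF m(1) _ _ T nl] m unfolding I by auto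
    then obtain l where l: "m = i + size l + 1"
      "edges i l = (if m = i + 1 then {} else insert {i, m} (T \<inter> chords {i..m}))"
      using less.hyps[of m i "T \<inter> chords {i..m}"] m by (meson diff_less_mono less_imp_le_nat)
    have "triang {m..j} (T \<inter> chords {m..j})"
      using triang_restrict_left[OF m(2) _ _ T nr] m unfolding I by auto
    then obtain r where r: "j = m + size r + 1"
      "edges m r = (if j = m + 1 then {} else insert {m, j} (T \<inter> chords {m..j}))"
      using less.hyps[of j m "T \<inter> chords {m..j}"] m by (meson diff_less_mono2 less_trans)
    have "edges i (Node l r) = insert {i, j} (edges i l \<union> edges m r)" using l(1) r(1) by simp
    also have "\<dots> = insert {i, j} T"
    proof
      \<comment> \<open>A side of the root triangle that joins non-consecutive points is a chord
        crossing nothing in \<open>T\<close>, so maximality puts it into \<open>T\<close>.\<close>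
      have "{i, m} \<in> T" if "m \<noteq> i + 1"
        by (rule triang_maximal[OF T _ nl], subst chords_iff) (use m that in \<open>auto intro: bexI[of _ "i + 1"] bexI[of _ j]\<close>)
      moreover have "{m, j} \<in> T" if "j \<noteq> m + 1"
        by (rule triang_maximal[OF T _ nr], subst chords_iff) (use m that in \<open>auto intro: bexI[of _ "m + 1"] bexI[of _ i]\<close>)
      ultimately show "insert {i, j} (edges i l \<union> edges m r) \<subseteq> insert {i, j} T"
        unfolding l(2) r(2) by auto
      have "e \<in> edges i l \<union> edges m r" if e: "e \<in> T" for e
      proof -
        have "e \<in> chords {i..j}" using e T triang_subset by blast
        then obtain p q x y where pq: "e = {p, q}" "p < q" "p \<in> {i..j}" "q \<in> {i..j}"
          "x \<in> {i..j}" "p < x" "x < q" "y \<in> {i..j}" "y < p \<or> q < y" by (rule chordsE)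
        have "\<not> crosses {i, m} e" "\<not> crosses {m, j} e" using nl nr e by auto
        then have "\<not> (i < p \<and> p < m \<and> m < q)" "\<not> (p < m \<and> m < q \<and> q < j)"
          using pq m by (auto simp: crosses_iff)
        then consider "q \<le> m" | "m \<le> p" using pq by fastforce
        then show ?thesis
        proof cases
          case 1
          then have "m \<noteq> i + 1" using pq by auto
          moreover have "e = {i, m} \<or> e \<in> chords {i..m}"
          proof (cases "p = i \<and> q = m")
            case False
            then have "i < p \<or> q < m" using pq 1 by auto
            then have "{p, q} \<in> chords {i..m}"
              unfolding chords_iff[OF pq(2)] using pq 1 m by (auto intro: bexI[of _ x] bexI[of _ i] bexI[of _ m])
            then show ?thesis using pq by simp
          qed (use pq in simp)
          ultimately show ?thesis using e l(2) by auto
        next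
          case 2
          then have "j \<noteq> m + 1" using pq by auto
          moreover have "e = {m, j} \<or> e \<in> chords {m..j}"
          proof (cases "p = m \<and> q = j")
            case False
            then have "m < p \<or> q < j" using pq 2 by auto
            then have "{p, q} \<in> chords {m..j}"
              unfolding chords_iff[OF pq(2)] using pq 2 m by (auto intro: bexI[of _ x] bexI[of _ m] bexI[of _ j])
            then show ?thesis using pq by simp
          qed (use pq in simp)
          ultimately show ?thesis using e r(2) by auto
        qed
      qed
      then show "insert {i, j} T \<subseteq> insert {i, j} (edges i l \<union> edges m r)" by blast
    qed
    finally show ?thesis using False l(1) r(1) by (intro exI[of _ "Node l r"]) simp
  qed
qed

lemma triang_pair:
  assumes "triang {i..j} T" "i + 1 < j"
  obtains l r m where "m = i + size l + 1" "j = m + size r + 1" "T = edges i l \<union> edges m r"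
proof -
  obtain t where t: "j = i + size t + 1" "edges i t = insert {i, j} T"
    using triang_interval_tree[OF assms(1)] assms(2) by auto
  then obtain l r where lr: "t = Node l r" using assms(2) by (cases t) auto
  define m where m: "m = i + size l + 1"
  have j: "j = m + size r + 1" using t(1) lr m by simp
  have "insert {i, j} T = insert {i, j} (edges i l \<union> edges m r)"
    using t(2) unfolding lr by (simp add: m j)
  moreover have "{i, j} \<notin> T"
    using triang_subset[OF assms(1)] assms(2) chords_iff[of i j "{i..j}"] by auto
  moreover have "{i, j} \<notin> edges i l" using edges_bounds(2)[of i j i l] m j by auto
  moreover have "{i, j} \<notin> edges m r" using edges_bounds(1)[of i j m r] m by auto
  ultimately have "T = edges i l \<union> edges m r" by (simp add: insert_ident)
  then show thesis by (rule that[OF m j])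
qed

section \<open>The polygon\<close>

lemma is_side_iff:
  assumes "a < b" "b < n"
  shows "is_side n a b \<longleftrightarrow> b = a + 1 \<or> (a = 0 \<and> b + 1 = n)"
proof -
  have "(a + 1) mod n = a + 1" using assms by simp
  moreover have "(b + 1) mod n = (if b + 1 = n then 0 else b + 1)" using assms by simp
  ultimately show ?thesis using assms unfolding is_side_def by auto
qed

lemma is_side_sym: "is_side n a b \<longleftrightarrow> is_side n b a"
  unfolding is_side_def by blast

lemma diagonals_iff:
  assumes "a < b"
  shows "{a, b} \<in> diagonals n \<longleftrightarrow> b < n \<and> \<not> is_side n a b"
proof
  assume "{a, b} \<in> diagonals n"
  then obtain p q where "{a, b} = {p, q}" "p < n" "q < n" "\<not> is_side n p q" unfolding diagonals_def by blast
  then show "b < n \<and> \<not> is_side n a b" using is_side_sym[of n a b] by (auto simp: doubleton_eq_iff)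
next
  assume "b < n \<and> \<not> is_side n a b"
  then show "{a, b} \<in> diagonals n" using assms unfolding diagonals_def
    by (intro CollectI exI[of _ a] exI[of _ b]) auto
qed

text \<open>The lack of a vertex between \<open>a\<close> and \<open>b\<close> means consecutive
  vertices, the lack of one outside means the side from 0 to \<open>n - 1\<close>. For
  \<open>n = 0\<close> both sets are empty.\<close>

lemma diagonals_eq_chords: "diagonals n = chords {0..n - 1}"
proof -
  have "{a, b} \<in> diagonals n \<longleftrightarrow> {a, b} \<in> chords {0..n - 1}" if ab: "a < b" for a b
  proof (cases "b < n")
    case True
    have "(\<exists>x\<in>{0..n - 1}. a < x \<and> x < b) \<longleftrightarrow> b \<noteq> a + 1"
      using ab True by (auto intro: bexI[of _ "a + 1"])
    moreover have "(\<exists>x\<in>{0..n - 1}. x < a \<or> b < x) \<longleftrightarrow> \<not> (a = 0 \<and> b + 1 = n)"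
      using ab True by (auto intro: bexI[of _ 0] bexI[of _ "n - 1"])
    ultimately show ?thesis
      using ab True by (auto simp: diagonals_iff[OF ab] chords_iff[OF ab] is_side_iff[OF ab True])
  next
    case False
    then show ?thesis using ab by (auto simp: diagonals_iff[OF ab] chords_iff[OF ab])
  qed
  moreover have "\<exists>a b. a < b \<and> e = {a, b}" if "e \<in> diagonals n" for e
  proof -
    obtain p q where "e = {p, q}" "p \<noteq> q" using \<open>e \<in> diagonals n\<close> unfolding diagonals_def by blast
    then show ?thesis by (metis insert_commute linorder_neqE_nat)
  qed
  moreover have "\<exists>a b. a < b \<and> e = {a, b}" if "e \<in> chords {0..n - 1}" for e
    using that by (elim chordsE) blast
  ultimately show ?thesis by blast
qed

lemma triangulation_iff_triang: "triangulation n T \<longleftrightarrow> triang {0..n - 1} T"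
proof
  assume T: "triangulation n T"
  then have sub: "T \<subseteq> chords {0..n - 1}" and nc: "noncrossing T"
    and mx: "\<And>d. d \<in> chords {0..n - 1} \<Longrightarrow> d \<notin> T \<Longrightarrow> \<not> noncrossing (insert d T)"
    unfolding triangulation_def diagonals_eq_chords by auto
  have "d \<in> T" if d: "d \<in> chords {0..n - 1}" "\<forall>e\<in>T. \<not> crosses d e" for d
  proof (rule ccontr)
    assume "d \<notin> T"
    moreover have "noncrossing (insert d T)"
      using nc d(2) not_crosses_self[OF d(1)] unfolding noncrossing_def
      by (metis crosses_sym insert_iff)
    ultimately show False using mx d by blast
  qed
  then show "triang {0..n - 1} T" using sub nc unfolding triang_def noncrossing_def by blast
next
  assume T: "triang {0..n - 1} T"
  then show "triangulation n T"
    unfolding triangulation_def diagonals_eq_chords noncrossing_def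
    using triang_subset[OF T] triangD[OF T] triang_maximal[OF T] by blast
qed

lemma internal_triangles_eq_closed_triples:
  assumes "T \<subseteq> diagonals n"
  shows "internal_triangles n T = closed_triples T"
proof
  show "internal_triangles n T \<subseteq> closed_triples T"
  proof
    fix x assume x: "x \<in> internal_triangles n T"
    then obtain a b c where abc: "x = {a, b, c}" "a < b" "b < c"
      "is_side n a b \<or> {a, b} \<in> T" "is_side n b c \<or> {b, c} \<in> T" "is_side n a c \<or> {a, c} \<in> T"
      unfolding internal_triangles_def triangles_def by blast
    moreover have "\<not> is_side n a b" "\<not> is_side n b c" "\<not> is_side n a c"
      using x abc(1-3) unfolding internal_triangles_def by auto
    ultimately show "x \<in> closed_triples T" unfolding closed_triples_def by blast
  qed
  show "closed_triples T \<subseteq> internal_triangles n T"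
  proof
    fix x assume "x \<in> closed_triples T"
    then obtain a b c where abc: "x = {a, b, c}" "a < b" "b < c"
      "{a, b} \<in> T" "{b, c} \<in> T" "{a, c} \<in> T" unfolding closed_triples_def by blast
    then have "{a, b} \<in> diagonals n" "{b, c} \<in> diagonals n" "{a, c} \<in> diagonals n" using assms by auto
    then have s: "c < n" "\<not> is_side n a b" "\<not> is_side n b c" "\<not> is_side n a c"
      using abc(2,3) by (auto simp: diagonals_iff)
    then have "x \<in> triangles n T" using abc unfolding triangles_def by blast
    moreover have "\<forall>i\<in>x. \<forall>j\<in>x. i \<noteq> j \<longrightarrow> \<not> is_side n i j"
      using s is_side_sym[of n] unfolding abc(1) by blast
    ultimately show "x \<in> internal_triangles n T" unfolding internal_triangles_def by blast
  qed
qed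

text \<open>The polygon is rooted at the side from 0 to \<open>n - 1\<close>. The triangle on that
  side is a node of neither tree, so the two sizes add up to one less than the \<open>n - 2\<close>
  triangles.\<close>

lemma triangulation_tree_pair:
  assumes "n \<ge> 4" "triangulation n T"
  obtains l r where "size l + size r + 3 = n"
    "internal_triangles n T = branchings 0 l \<union> branchings (size l + 1) r"
    "int (card {T'. triangulation n T' \<and> disjoint_triangs T' T}) = act_pair l r"
proof -
  have T: "triang {0..n - 1} T" using assms(2) triangulation_iff_triang by blast
  obtain l r m where lr: "m = 0 + size l + 1" "n - 1 = m + size r + 1" "T = edges 0 l \<union> edges m r"
    by (rule triang_pair[OF T]) (use assms(1) in auto)
  have "internal_triangles n T = closed_triples T"
    using internal_triangles_eq_closed_triples triang_subset[OF T] diagonals_eq_chords by blast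
  then have "internal_triangles n T = branchings 0 l \<union> branchings (size l + 1) r"
    using lr closed_triples_pair[OF lr(1), of r] closed_triples_edges by simp
  moreover have "int (card {T'. triangulation n T' \<and> disjoint_triangs T' T}) = act_pair l r"
    using avoiding_polygon_pair[OF tree_counts tree_counts lr(1,2)] lr(3)
    by (simp add: avoiding_def triangulation_iff_triang disjoint_triangs_def)
  moreover have "size l + size r + 3 = n" using lr assms by simp
  ultimately show thesis using that by blast
qed

theorem theorem3p3:
  fixes n :: nat and T1 T2 :: "nat set set"
  assumes "n \<ge> 4"
    and "triangulation n T1" and "triangulation n T2"
    and "internal_triangles n T1 = internal_triangles n T2"
  shows "card {T. triangulation n T \<and> disjoint_triangs T T1}
       = card {T. triangulation n T \<and> disjoint_triangs T T2}"
proof -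
  obtain l1 r1 where 1: "size l1 + size r1 + 3 = n"
    "internal_triangles n T1 = branchings 0 l1 \<union> branchings (size l1 + 1) r1"
    "int (card {T. triangulation n T \<and> disjoint_triangs T T1}) = act_pair l1 r1"
    by (rule triangulation_tree_pair[OF assms(1,2)])
  obtain l2 r2 where 2: "size l2 + size r2 + 3 = n"
    "internal_triangles n T2 = branchings 0 l2 \<union> branchings (size l2 + 1) r2"
    "int (card {T. triangulation n T \<and> disjoint_triangs T T2}) = act_pair l2 r2"
    by (rule triangulation_tree_pair[OF assms(1,3)])
  have "act_pair l1 r1 = act_pair l2 r2"
    using 1(1,2) 2(1,2) assms(4)
    by (intro act_pair_eqI[of 0 l1 "size l1 + 1" r1 0 l2 "size l2 + 1" r2]) auto
  then show ?thesis using 1(3) 2(3) by simp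
qed

end
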